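(* Let $m$ be an arbitrary positive integer. Then the following identity of formal series in $q$ holds: $$\sum_{(k_1,\dots,k_{4m-1})\in\mathbb{Z}^{4m-1}} q^{(4m-1)\,\kappa(k_1,\dots,k_{4m-1})+\mathrm{lin}(k_1,\dots,k_{4m-1})}=\frac{\varphi(q^{4m-1})^{4m-1}\,\varphi(q^{2m})^{2}}{\varphi(q)\,\varphi(q^{m})},$$ where $$\mathrm{lin}(k_1,\dots,k_{4m-1})=(2m-1)k_1-k_2-\cdots-k_{3m-1}+(4m-2)k_{3m}-k_{3m+1}-\cdots-k_{4m-1},$$ that is, $\mathrm{lin}(k_1,\dots,k_{4m-1})=(2m-1)k_1+(4m-2)k_{3m}-\sum_{2\le i\le 4m-1,\ i\ne 3m}k_i$.
   Context: $\varphi(q)=\prod_{j\ge 1}(1-q^{j})$ denotes Euler's product function. For $l\ge 1$, $$\kappa(k_1,\dots,k_l)=k_1^2+k_2^2+\cdots+k_l^2-k_1k_2-k_2k_3-\cdots-k_{l-1}k_l,$$ used here with $l=4m-1$. *)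

theory Defs
  imports
    "HOL-Analysis.Infinite_Sum"
    "HOL-Analysis.Infinite_Products"
    "HOL-Computational_Algebra.Formal_Laurent_Series"
begin

text \<open>
  The argument ranges over a topological ring. Formal Laurent series carry the library's metric,
  in which a sequence converges iff for every degree \<open>N\<close> its coefficients up to \<open>N\<close> are
  eventually constant; the product then converges at \<open>fls_X ^ a\<close> for \<open>a \<ge> 1\<close> and equals the
  formal series $\varphi(q^a)$.
\<close>

definition euler_phi :: "'a \<Rightarrow> 'a :: {t2_space, comm_ring_1}" where
  "euler_phi q = (\<Prod>j. 1 - q ^ Suc j)"

text \<open>
  A tuple $(k_1, \dots, k_l)$ is a function on \<^typ>\<open>nat\<close>, of which only the values
  on \<open>{1..l}\<close> are used.
\<close>

definition kappa :: "nat \<Rightarrow> (nat \<Rightarrow> int) \<Rightarrow> int" where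
  "kappa l k = (\<Sum>i=1..l. (k i)\<^sup>2) - (\<Sum>i=1..<l. k i * k (i + 1))"

definition lin :: "nat \<Rightarrow> (nat \<Rightarrow> int) \<Rightarrow> int" where
  "lin m k = (2 * int m - 1) * k 1 + (4 * int m - 2) * k (3 * m)
             - (\<Sum>i\<in>{2..4 * m - 1} - {3 * m}. k i)"

text \<open>$\mathbb{Z}^l$, indexed by $1, \dots, l$; functions are \<^term>\<open>undefined\<close> outside
  the index range, so that each tuple is represented exactly once.\<close>

definition int_tuples :: "nat \<Rightarrow> (nat \<Rightarrow> int) set" where
  "int_tuples l = ({1..l} \<rightarrow>\<^sub>E UNIV)"

end

theory Submission
  imports Defs
begin

text \<open>
  In the coordinates $x_i = k_i - k_{i-1}$ (with $k_0 = k_{4m} = 0$) the exponent is a sum of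
  one-variable exponents $n x_i (x_i - 1)/2 + r_i x_i$ with $n = 4m - 1$, subject to
  $x_1 + \cdots + x_{4m} = 0$, where $r_1 = 3m - 1$ and $r_2, \dots, r_{4m}$ run once
  through all residues modulo $n$. So the left-hand side is the constant term in $z$ of a product
  of $4m$ theta functions of base $q^n$; those with $i \ge 2$ multiply, up to Euler products, to a theta function
  of base $q$, and the constant term of the remaining product of two is
  $\sum_b q^{2mb^2 + mb}$, which the Jacobi triple product evaluates.

  To stay within one-variable series, the theta functions are replaced by finite products, which are
  Laurent polynomials in $z$ with Gaussian binomial coefficients, and the limit is taken only
  after comparing coefficients.
\<close>

subsection \<open>Convergence of formal Laurent series\<close>

definition order_ge :: "int \<Rightarrow> 'a::zero fls \<Rightarrow> bool" where
  "order_ge M f \<longleftrightarrow> (\<forall>k<M. fls_nth f k = 0)"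

lemma order_ge_iff_subdegree: "order_ge M f \<longleftrightarrow> f = 0 \<or> M \<le> fls_subdegree f"
  unfolding order_ge_def
  by (metis fls_eq0_below_subdegree fls_subdegree_geI fls_zero_nth order_less_le_trans)

lemma order_ge_mono: "order_ge M f \<Longrightarrow> M' \<le> M \<Longrightarrow> order_ge M' f"
  by (simp add: order_ge_def)

lemma order_ge_0 [simp]: "order_ge M 0"
  by (simp add: order_ge_def)

lemma order_ge_1 [simp]: "order_ge 0 1"
  by (simp add: order_ge_def)

lemma order_ge_add:
  fixes f g :: "'a::monoid_add fls"
  shows "order_ge M f \<Longrightarrow> order_ge M g \<Longrightarrow> order_ge M (f + g)"
  by (simp add: order_ge_def)

lemma order_ge_minus_iff:
  fixes f :: "'a::group_add fls"
  shows "order_ge M (- f) \<longleftrightarrow> order_ge M f"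
  by (simp add: order_ge_def)

lemma order_ge_diff:
  fixes f g :: "'a::group_add fls"
  shows "order_ge M f \<Longrightarrow> order_ge M g \<Longrightarrow> order_ge M (f - g)"
  by (simp add: order_ge_def)

lemma order_ge_sum:
  fixes f :: "'i \<Rightarrow> 'a::comm_monoid_add fls"
  assumes "\<And>i. i \<in> A \<Longrightarrow> order_ge M (f i)"
  shows "order_ge M (sum f A)"
  using assms by (induction A rule: infinite_finite_induct) (auto intro: order_ge_add)

lemma order_ge_mult:
  fixes f g :: "'a::field fls"
  assumes "order_ge M f" "order_ge M' g"
  shows "order_ge (M + M') (f * g)"
  using assms by (cases "f = 0 \<or> g = 0") (auto simp: order_ge_iff_subdegree)

lemma order_ge_mult_0:
  fixes f g :: "'a::field fls"
  shows "order_ge 0 f \<Longrightarrow> order_ge 0 g \<Longrightarrow> order_ge 0 (f * g)"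
  using order_ge_mult[of 0 f 0 g] by simp

lemma order_ge_prod_0:
  fixes f :: "'i \<Rightarrow> 'a::field fls"
  assumes "\<And>i. i \<in> A \<Longrightarrow> order_ge 0 (f i)"
  shows "order_ge 0 (prod f A)"
  using assms by (induction A rule: infinite_finite_induct) (auto intro: order_ge_mult_0)

lemma order_ge_X_powi: "order_ge e (fls_X powi e :: 'a::field fls)"
  by (simp add: order_ge_iff_subdegree)

lemma tendsto_fls_iff:
  fixes X :: "'b \<Rightarrow> 'a::group_add fls"
  shows "(X \<longlongrightarrow> L) F \<longleftrightarrow> (\<forall>M. \<forall>\<^sub>F x in F. order_ge M (X x - L))"
proof
  assume lim: "(X \<longlongrightarrow> L) F"
  show "\<forall>M. \<forall>\<^sub>F x in F. order_ge M (X x - L)"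
  proof
    fix M :: int
    define N where "N = nat \<bar>M\<bar>"
    have "\<forall>\<^sub>F x in F. dist (X x) L < inverse (2 ^ N)"
      using lim by (rule tendstoD) simp
    then show "\<forall>\<^sub>F x in F. order_ge M (X x - L)"
    proof (eventually_elim)
      case (elim x)
      show ?case
      proof (rule ccontr)
        assume "\<not> ?case"
        then have neq: "X x \<noteq> L" and lt: "fls_subdegree (X x - L) < M"
          by (auto simp: order_ge_iff_subdegree)
        have "inverse (2 ^ N) \<le> dist (X x) L"
        proof (cases "fls_subdegree (X x - L) \<ge> 0")
          case True
          then have "nat (fls_subdegree (X x - L)) \<le> N"
            using lt by (simp add: N_def)
          then show ?thesis
            using neq True by (simp add: dist_fls_def)
        next
          case False
          have "inverse (2 ^ N) \<le> (1::real)"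
            by (simp add: inverse_le_1_iff)
          also have "\<dots> \<le> 2 ^ nat (- fls_subdegree (X x - L))"
            by simp
          finally show ?thesis
            using neq False by (simp add: dist_fls_def)
        qed
        with elim show False by simp
      qed
    qed
  qed
next
  assume *: "\<forall>M. \<forall>\<^sub>F x in F. order_ge M (X x - L)"
  show "(X \<longlongrightarrow> L) F"
  proof (rule tendstoI)
    fix e :: real assume "e > 0"
    then obtain N where N: "inverse (2 ^ N) < e"
      using real_arch_pow_inv[of e "1/2"] by (auto simp: power_one_over field_simps)
    show "\<forall>\<^sub>F x in F. dist (X x) L < e"
      using *[rule_format, of "int N"]
    proof eventually_elim
      case (elim x)
      show ?case
      proof (cases "X x = L")
        case False
        then have ge: "int N \<le> fls_subdegree (X x - L)"
          using elim by (simp add: order_ge_iff_subdegree)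
        then have "N \<le> nat (fls_subdegree (X x - L))"
          by simp
        then have "dist (X x) L \<le> inverse (2 ^ N)"
          using False ge by (simp add: dist_fls_def)
        with N show ?thesis by simp
      qed (use \<open>e > 0\<close> in simp)
    qed
  qed
qed

lemma convergent_fls:
  fixes X :: "'b \<Rightarrow> 'a::group_add fls"
  assumes bound: "\<forall>\<^sub>F x in F. order_ge b (X x)"
    and stable: "\<And>k. \<exists>c. \<forall>\<^sub>F x in F. fls_nth (X x) k = c"
  obtains L where "(X \<longlongrightarrow> L) F" "order_ge b L"
proof -
  from stable obtain c where c: "\<And>k. \<forall>\<^sub>F x in F. fls_nth (X x) k = c k"
    by metis
  define L where "L = Abs_fls (\<lambda>k. if k < b then 0 else c k)"
  have L: "fls_nth L k = (if k < b then 0 else c k)" for k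
    unfolding L_def by (subst nth_Abs_fls_lower_bound[of b]) auto
  have "(X \<longlongrightarrow> L) F"
    unfolding tendsto_fls_iff
  proof
    fix M
    have "\<forall>\<^sub>F x in F. \<forall>k\<in>{b..<M}. fls_nth (X x) k = c k"
      by (rule eventually_ball_finite) (use c in auto)
    then show "\<forall>\<^sub>F x in F. order_ge M (X x - L)"
      using bound
    proof eventually_elim
      case (elim x)
      show ?case
        unfolding order_ge_def
      proof (intro allI impI)
        fix k assume "k < M"
        then show "fls_nth (X x - L) k = 0"
          using elim by (cases "k < b") (auto simp: L order_ge_def)
      qed
    qed
  qed
  moreover have "order_ge b L"
    by (simp add: order_ge_def L)
  ultimately show thesis
    by (rule that)
qed

lemma tendsto_add_fls:
  fixes X Y :: "'b \<Rightarrow> 'a::ab_group_add fls"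
  assumes "(X \<longlongrightarrow> L) F" "(Y \<longlongrightarrow> K) F"
  shows "((\<lambda>x. X x + Y x) \<longlongrightarrow> L + K) F"
  unfolding tendsto_fls_iff
proof
  fix M
  show "\<forall>\<^sub>F x in F. order_ge M (X x + Y x - (L + K))"
    using assms[unfolded tendsto_fls_iff, rule_format, of M]
    by eventually_elim (auto simp: add_diff_add intro: order_ge_add)
qed

lemma tendsto_mult_fls:
  fixes X Y :: "'b \<Rightarrow> 'a::field fls"
  assumes "(X \<longlongrightarrow> L) F" "(Y \<longlongrightarrow> K) F"
  shows "((\<lambda>x. X x * Y x) \<longlongrightarrow> L * K) F"
  unfolding tendsto_fls_iff
proof
  fix M
  define l where "l = min 0 (fls_subdegree L)"
  define k where "k = min 0 (fls_subdegree K)"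
  have L: "order_ge l L" and K: "order_ge k K"
    by (auto simp: order_ge_iff_subdegree l_def k_def)
  have "\<forall>\<^sub>F x in F. order_ge (\<bar>M\<bar> - k) (X x - L)" "\<forall>\<^sub>F x in F. order_ge (\<bar>M\<bar> - l) (Y x - K)"
    using assms unfolding tendsto_fls_iff by blast+
  then show "\<forall>\<^sub>F x in F. order_ge M (X x * Y x - L * K)"
  proof eventually_elim
    case (elim x)
    have "order_ge M ((X x - L) * (Y x - K))"
      using order_ge_mult[OF elim] by (rule order_ge_mono) (auto simp: l_def k_def)
    moreover have "order_ge M (L * (Y x - K))"
      using order_ge_mult[OF L elim(2)] by (rule order_ge_mono) auto
    moreover have "order_ge M ((X x - L) * K)"
      using order_ge_mult[OF elim(1) K] by (rule order_ge_mono) auto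
    ultimately have "order_ge M ((X x - L) * (Y x - K) + L * (Y x - K) + (X x - L) * K)"
      by (intro order_ge_add)
    then show ?case
      by (simp add: algebra_simps)
  qed
qed

lemma tendsto_prod_fls:
  fixes X :: "'i \<Rightarrow> 'b \<Rightarrow> 'a::field fls"
  assumes "\<And>i. i \<in> A \<Longrightarrow> (X i \<longlongrightarrow> L i) F"
  shows "((\<lambda>x. \<Prod>i\<in>A. X i x) \<longlongrightarrow> (\<Prod>i\<in>A. L i)) F"
  using assms by (induction A rule: infinite_finite_induct) (auto intro: tendsto_mult_fls)

lemma tendsto_inverse_fls:
  fixes X :: "'b \<Rightarrow> 'a::field fls"
  assumes X: "(X \<longlongrightarrow> L) F" and "L \<noteq> 0"
  shows "((\<lambda>x. inverse (X x)) \<longlongrightarrow> inverse L) F"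
  unfolding tendsto_fls_iff
proof
  fix M
  define l where "l = fls_subdegree L"
  have "\<forall>\<^sub>F x in F. order_ge (M + 2 * l) (X x - L)" "\<forall>\<^sub>F x in F. order_ge (l + 1) (X x - L)"
    using X unfolding tendsto_fls_iff by blast+
  then show "\<forall>\<^sub>F x in F. order_ge M (inverse (X x) - inverse L)"
  proof eventually_elim
    case (elim x)
    have "fls_nth (X x - L) k = 0" if "k \<le> l" for k
      using elim(2) that by (auto simp: order_ge_def)
    then have nth: "fls_nth (X x) k = fls_nth L k" if "k \<le> l" for k
      using that by auto
    have "fls_nth (X x) l \<noteq> 0"
      using nth[of l] \<open>L \<noteq> 0\<close> by (simp add: l_def)
    moreover have "fls_nth (X x) k = 0" if "k < l" for k
      using nth[of k] that by (simp add: l_def)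
    ultimately have sd: "fls_subdegree (X x) = l" and nz: "X x \<noteq> 0"
      by (auto intro: fls_subdegree_eqI)
    have "inverse (X x) - inverse L = (X x - L) * (- inverse (X x) * inverse L)"
      using nz \<open>L \<noteq> 0\<close> by (simp add: field_simps)
    moreover have "order_ge (- l + - l) (inverse (X x) * inverse L)"
      by (intro order_ge_mult) (use nz \<open>L \<noteq> 0\<close> sd in \<open>auto simp: order_ge_iff_subdegree l_def\<close>)
    ultimately show ?case
      using order_ge_mult[OF elim(1), of "- l + - l" "- inverse (X x) * inverse L"]
      by (simp add: order_ge_minus_iff)
  qed
qed

lemma tendsto_divide_fls:
  fixes X Y :: "'b \<Rightarrow> 'a::field fls"
  assumes "(X \<longlongrightarrow> L) F" "(Y \<longlongrightarrow> K) F" "K \<noteq> 0"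
  shows "((\<lambda>x. X x / Y x) \<longlongrightarrow> L / K) F"
  unfolding divide_inverse by (intro tendsto_mult_fls tendsto_inverse_fls assms)

lemma has_sum_X_powi_exists:
  fixes f :: "'i \<Rightarrow> int"
  assumes "\<And>x. x \<in> A \<Longrightarrow> b \<le> f x"
    and "\<And>M. finite {x \<in> A. f x \<le> M}"
  shows "\<exists>S. ((\<lambda>x. fls_X powi f x :: 'a::field fls) has_sum S) A"
proof -
  let ?g = "\<lambda>x. fls_X powi f x :: 'a fls"
  have "\<forall>\<^sub>F Y in finite_subsets_at_top A. order_ge b (sum ?g Y)"
  proof (rule eventually_finite_subsets_at_top_weakI)
    fix Y assume "finite Y" "Y \<subseteq> A"
    then show "order_ge b (sum ?g Y)"
      using assms(1) by (intro order_ge_sum order_ge_mono[OF order_ge_X_powi]) auto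
  qed
  moreover have "\<exists>c. \<forall>\<^sub>F Y in finite_subsets_at_top A. fls_nth (sum ?g Y) k = c" for k
  proof -
    let ?B = "{x \<in> A. f x \<le> k}"
    have "fls_nth (sum ?g Y) k = fls_nth (sum ?g ?B) k"
      if "finite Y" "?B \<subseteq> Y" "Y \<subseteq> A" for Y
    proof -
      have "sum ?g Y = sum ?g (Y - ?B) + sum ?g ?B"
        using that by (simp add: sum.subset_diff)
      moreover have "order_ge (k + 1) (sum ?g (Y - ?B))"
        using that by (intro order_ge_sum order_ge_mono[OF order_ge_X_powi]) auto
      ultimately show ?thesis
        by (simp add: order_ge_def)
    qed
    then show ?thesis
      unfolding eventually_finite_subsets_at_top using assms(2)[of k]
      by - (rule exI[of _ "fls_nth (sum ?g ?B) k"], rule exI[of _ ?B], blast)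
  qed
  ultimately obtain S where "(sum ?g \<longlongrightarrow> S) (finite_subsets_at_top A)"
    by (rule convergent_fls)
  then show ?thesis
    unfolding has_sum_def by blast
qed

lemma tendsto_weighted_sum:
  fixes f :: "'i \<Rightarrow> int" and u :: "nat \<Rightarrow> 'i \<Rightarrow> 'a::field fls"
  assumes S: "((\<lambda>x. fls_X powi f x) has_sum S) A"
    and bound: "\<And>x. x \<in> A \<Longrightarrow> b \<le> f x"
    and fin: "\<And>M. finite {x \<in> A. f x \<le> M}"
    and B: "filterlim B (finite_subsets_at_top A) sequentially"
    and u: "\<And>x. x \<in> A \<Longrightarrow> (\<lambda>N. u N x) \<longlonglongrightarrow> c"
    and u0: "\<And>N x. x \<in> B N \<Longrightarrow> order_ge 0 (u N x)"
    and c0: "order_ge 0 c"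
  shows "(\<lambda>N. \<Sum>x\<in>B N. u N x * fls_X powi f x) \<longlonglongrightarrow> c * S"
proof -
  have sub: "\<forall>\<^sub>F N in sequentially. B N \<subseteq> A"
    using B unfolding filterlim_finite_subsets_at_top by (auto elim!: allE[of _ "{}"] eventually_mono)
  have "(\<lambda>N. \<Sum>x\<in>B N. (u N x - c) * fls_X powi f x) \<longlonglongrightarrow> 0"
    unfolding tendsto_fls_iff diff_0_right
  proof
    fix M
    have "\<forall>\<^sub>F N in sequentially. \<forall>x\<in>{x\<in>A. f x \<le> M}. order_ge (M - b) (u N x - c)"
      using u by (intro eventually_ball_finite fin) (auto simp: tendsto_fls_iff)
    then show "\<forall>\<^sub>F N in sequentially. order_ge M (\<Sum>x\<in>B N. (u N x - c) * fls_X powi f x)"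
      using sub
    proof eventually_elim
      case (elim N)
      show ?case
      proof (rule order_ge_sum)
        fix x assume x: "x \<in> B N"
        show "order_ge M ((u N x - c) * fls_X powi f x)"
        proof (cases "f x \<le> M")
          case True
          then have "order_ge (M - b) (u N x - c)"
            using elim x by auto
          from order_ge_mult[OF this order_ge_X_powi[of "f x"]] show ?thesis
            by (rule order_ge_mono) (use bound elim x in auto)
        next
          case False
          have "order_ge 0 (u N x - c)"
            using u0[OF x] c0 by (rule order_ge_diff)
          from order_ge_mult[OF this order_ge_X_powi[of "f x"]] show ?thesis
            by (rule order_ge_mono) (use False in auto)
        qed
      qed
    qed
  qed
  moreover have "(\<lambda>N. c * (\<Sum>x\<in>B N. fls_X powi f x)) \<longlonglongrightarrow> c * S"
    using S unfolding has_sum_def by (intro tendsto_mult_fls tendsto_const filterlim_compose[OF _ B])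
  ultimately have "(\<lambda>N. (\<Sum>x\<in>B N. (u N x - c) * fls_X powi f x) + c * (\<Sum>x\<in>B N. fls_X powi f x)) \<longlonglongrightarrow> 0 + c * S"
    by (rule tendsto_add_fls)
  moreover have "(\<Sum>x\<in>B N. (u N x - c) * fls_X powi f x) + c * (\<Sum>x\<in>B N. fls_X powi f x)
      = (\<Sum>x\<in>B N. u N x * fls_X powi f x)" for N
    by (simp add: sum_distrib_left sum.distrib[symmetric] algebra_simps)
  ultimately show ?thesis
    by simp
qed

subsection \<open>Partial products of Euler's function\<close>

definition euler_poly :: "nat \<Rightarrow> 'a \<Rightarrow> 'a::comm_ring_1" where
  "euler_poly N p = (\<Prod>j<N. 1 - p ^ Suc j)"

lemma euler_poly_0 [simp]: "euler_poly 0 p = 1"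
  by (simp add: euler_poly_def)

lemma euler_poly_Suc: "euler_poly (Suc N) p = euler_poly N p * (1 - p ^ Suc N)"
  by (simp add: euler_poly_def)

lemma fls_nth_euler_poly_0:
  assumes "d \<ge> 1"
  shows "fls_nth (euler_poly N ((fls_X :: 'a::field fls) ^ d)) 0 = 1 \<and>
    order_ge 0 (euler_poly N ((fls_X :: 'a::field fls) ^ d))"
proof (induction N)
  case (Suc N)
  let ?p = "(fls_X :: 'a fls) ^ d"
  have "order_ge (int (d * Suc N)) (?p ^ Suc N)"
    by (simp only: power_mult[symmetric] order_ge_iff_subdegree fls_subdegree_fls_X_pow) simp
  from order_ge_mult[OF conjunct2[OF Suc] this]
  have *: "order_ge 1 (euler_poly N ?p * ?p ^ Suc N)"
    by (rule order_ge_mono) (use assms in \<open>auto intro: add_increasing2\<close>)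
  have "euler_poly (Suc N) ?p = euler_poly N ?p - euler_poly N ?p * ?p ^ Suc N"
    by (simp add: euler_poly_Suc algebra_simps)
  then show ?case
    using * Suc by (auto simp: order_ge_def simp del: power_Suc)
qed (auto simp: order_ge_def)

lemma fls_subdegree_eq_0I:
  assumes "order_ge 0 f" "fls_nth f 0 \<noteq> 0"
  shows "f \<noteq> 0" "fls_subdegree f = 0"
  using assms by (auto simp: order_ge_def intro: fls_subdegree_eqI)

lemma
  fixes d :: nat
  assumes "d \<ge> 1"
  shows euler_poly_nonzero: "euler_poly N ((fls_X :: 'a::field fls) ^ d) \<noteq> 0"
    and fls_subdegree_euler_poly: "fls_subdegree (euler_poly N ((fls_X :: 'a::field fls) ^ d)) = 0"
  using fls_nth_euler_poly_0[OF assms, of N, where 'a = 'a] fls_subdegree_eq_0I by fastforce+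

lemma
  fixes d :: nat
  assumes "d \<ge> 1"
  shows tendsto_euler_phi: "(\<lambda>N. euler_poly N ((fls_X :: 'a::field fls) ^ d)) \<longlonglongrightarrow> euler_phi (fls_X ^ d)"
    and euler_phi_nonzero: "euler_phi ((fls_X :: 'a::field fls) ^ d) \<noteq> 0"
    and fls_subdegree_euler_phi: "fls_subdegree (euler_phi ((fls_X :: 'a::field fls) ^ d)) = 0"
proof -
  let ?p = "(fls_X :: 'a fls) ^ d"
  have incr: "order_ge (int (Suc N)) (euler_poly (Suc N) ?p - euler_poly N ?p)" for N
  proof -
    have "order_ge (int (d * Suc N)) (?p ^ Suc N)"
      by (simp only: power_mult[symmetric] order_ge_iff_subdegree fls_subdegree_fls_X_pow) simp
    moreover have "int (Suc N) \<le> 0 + int (d * Suc N)"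
      using mult_le_mono1[OF assms, of "Suc N"] by (simp only: of_nat_le_iff add_0 mult_1)
    ultimately have "order_ge (int (Suc N)) (euler_poly N ?p * ?p ^ Suc N)"
      by (rule order_ge_mono[OF order_ge_mult[OF conjunct2[OF fls_nth_euler_poly_0[OF assms]]]])
    moreover have "euler_poly (Suc N) ?p - euler_poly N ?p = - (euler_poly N ?p * ?p ^ Suc N)"
      by (simp add: euler_poly_Suc algebra_simps)
    ultimately show ?thesis
      by (simp only: order_ge_minus_iff)
  qed
  have "\<forall>\<^sub>F N in sequentially. fls_nth (euler_poly N ?p) k = fls_nth (euler_poly (nat k) ?p) k" for k
    using eventually_ge_at_top[of "nat k"]
  proof eventually_elim
    case (elim N)
    then show ?case
    proof (induction N rule: dec_induct)
      case (step N)
      have "k < int (Suc N)"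
        using step.hyps by linarith
      then have "fls_nth (euler_poly (Suc N) ?p - euler_poly N ?p) k = 0"
        using incr[of N] unfolding order_ge_def by blast
      then have "fls_nth (euler_poly (Suc N) ?p) k = fls_nth (euler_poly N ?p) k"
        by simp
      then show ?case
        using step.IH by (rule trans)
    qed (rule refl)
  qed
  then have "\<exists>c. \<forall>\<^sub>F N in sequentially. fls_nth (euler_poly N ?p) k = c" for k
    by blast
  moreover have "\<forall>\<^sub>F N in sequentially. order_ge 0 (euler_poly N ?p)"
    using fls_nth_euler_poly_0[OF assms] by (intro always_eventually) blast
  ultimately obtain L where L: "(\<lambda>N. euler_poly N ?p) \<longlonglongrightarrow> L" "order_ge 0 L"
    using convergent_fls[of 0 "\<lambda>N. euler_poly N ?p" sequentially] by blast
  from L(1) have "\<forall>\<^sub>F N in sequentially. order_ge 1 (euler_poly N ?p - L)"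
    by (simp add: tendsto_fls_iff)
  then obtain N where "order_ge 1 (euler_poly N ?p - L)"
    by (auto simp: eventually_sequentially)
  then have "fls_nth L 0 = 1"
    using fls_nth_euler_poly_0[OF assms, of N, where 'a = 'a] by (simp add: order_ge_def)
  then have L0: "L \<noteq> 0" "fls_subdegree L = 0"
    using fls_subdegree_eq_0I[OF L(2)] by auto
  have "(\<lambda>j. 1 - ?p ^ Suc j) has_prod L"
    using L L0 LIMSEQ_Suc[OF L(1)]
    by (auto simp: has_prod_def raw_has_prod_def euler_poly_def lessThan_Suc_atMost)
  then have eq: "euler_phi ?p = L"
    unfolding euler_phi_def by (rule has_prod_unique[symmetric])
  show "(\<lambda>N. euler_poly N ?p) \<longlonglongrightarrow> euler_phi ?p" "euler_phi ?p \<noteq> 0" "fls_subdegree (euler_phi ?p) = 0"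
    unfolding eq by (fact L(1) L0)+
qed

subsection \<open>Finite theta products\<close>

definition gauss_binomial :: "'a::field \<Rightarrow> nat \<Rightarrow> nat \<Rightarrow> 'a" where
  "gauss_binomial p K k = euler_poly K p / (euler_poly k p * euler_poly (K - k) p)"

lemma gauss_binomial_Suc_Suc:
  fixes p :: "'a::field"
  assumes nz: "\<And>j. euler_poly j p \<noteq> 0" and "Suc k \<le> K"
  shows "gauss_binomial p (Suc K) (Suc k)
    = gauss_binomial p K (Suc k) + p ^ (K - k) * gauss_binomial p K k"
proof -
  obtain r where K: "K = Suc (k + r)"
    using assms(2) by (auto dest: le_Suc_ex)
  have nz': "1 - p ^ Suc j \<noteq> 0" for j
    using nz[of "Suc j"] by (auto simp: euler_poly_Suc)
  have A: "euler_poly (Suc K) p = euler_poly K p * (1 - p ^ (Suc k + Suc r))"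
    by (simp only: euler_poly_Suc K add_Suc_right add_Suc)
  have "x * (1 - a * b) / ((f * (1 - a)) * (g * (1 - b)))
      = x / ((f * (1 - a)) * g) + b * (x / (f * (g * (1 - b))))"
    if "1 - a \<noteq> 0" "1 - b \<noteq> 0" "f \<noteq> 0" "g \<noteq> 0" for x a b f g :: 'a
  proof -
    have "x / ((f * (1 - a)) * g) = x * (1 - b) / ((f * (1 - a)) * (g * (1 - b)))"
      using that by simp
    moreover have "b * (x / (f * (g * (1 - b)))) = b * x * (1 - a) / ((f * (1 - a)) * (g * (1 - b)))"
      using that by simp
    ultimately show ?thesis
      by (simp add: add_divide_distrib[symmetric] algebra_simps)
  qed
  from this[OF nz' nz' nz nz, of "euler_poly K p" k r k r] show ?thesis
    unfolding gauss_binomial_def A power_add by (simp add: K euler_poly_Suc)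
qed

lemma gauss_binomial_self:
  assumes "\<And>j. euler_poly j p \<noteq> 0"
  shows "gauss_binomial p K K = 1" "gauss_binomial p K 0 = 1"
  using assms by (auto simp: gauss_binomial_def)

lemma q_binomial_coeff:
  fixes p w :: "'a::field"
  assumes nz: "\<And>j. euler_poly j p \<noteq> 0"
  shows "coeff (\<Prod>t<K. [:1, p ^ t * w:]) k
    = (if k \<le> K then gauss_binomial p K k * p ^ (k * (k - 1) div 2) * w ^ k else 0)"
proof (induction K arbitrary: k)
  case 0
  then show ?case
    using nz by (auto simp: gauss_binomial_def coeff_1 split: nat.splits)
next
  case (Suc K)
  let ?P = "\<Prod>t<K. [:1, p ^ t * w:]"
  have P: "(\<Prod>t<Suc K. [:1, p ^ t * w:]) = ?P + pCons 0 (smult (p ^ K * w) ?P)"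
    by simp
  show ?case
  proof (cases k)
    case 0
    then show ?thesis
      unfolding P by (simp add: Suc gauss_binomial_self[OF nz])
  next
    case (Suc j)
    define c where "c = j * (j - 1) div 2"
    have "Suc j * (Suc j - 1) = j * (j - 1) + 2 * j"
      by (cases j) auto
    then have tri: "Suc j * (Suc j - 1) div 2 = c + j"
      by (simp add: c_def)
    have step: "coeff (\<Prod>t<Suc K. [:1, p ^ t * w:]) (Suc j) = coeff ?P (Suc j) + p ^ K * w * coeff ?P j"
      unfolding P by simp
    have IH1: "coeff ?P (Suc j) = (if Suc j \<le> K then gauss_binomial p K (Suc j) * p ^ (c + j) * w ^ Suc j else 0)"
      unfolding Suc.IH tri ..
    have IH0: "coeff ?P j = (if j \<le> K then gauss_binomial p K j * p ^ c * w ^ j else 0)"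
      unfolding Suc.IH c_def ..
    consider "Suc j \<le> K" | "j = K" | "j > K" by linarith
    then have "(if Suc j \<le> K then gauss_binomial p K (Suc j) * p ^ (c + j) * w ^ Suc j else 0)
        + p ^ K * w * (if j \<le> K then gauss_binomial p K j * p ^ c * w ^ j else 0)
      = (if Suc j \<le> Suc K then gauss_binomial p (Suc K) (Suc j) * p ^ (c + j) * w ^ Suc j else 0)"
    proof cases
      case 1
      have "p ^ K = p ^ (K - j) * p ^ j"
        using 1 by (simp flip: power_add)
      then show ?thesis
        using 1 by (simp add: gauss_binomial_Suc_Suc[OF nz 1] power_add algebra_simps)
    next
      case 2
      then show ?thesis
        by (simp add: gauss_binomial_self[OF nz] power_add algebra_simps)
    next
      case 3
      then show ?thesis by simp
    qed
    then show ?thesis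
      unfolding \<open>k = Suc j\<close> tri step IH1 IH0 .
  qed
qed

definition theta_exp :: "int \<Rightarrow> int \<Rightarrow> int \<Rightarrow> int" where
  "theta_exp n r x = n * (x * (x - 1) div 2) + r * x"

definition theta_shift :: "int \<Rightarrow> int \<Rightarrow> int \<Rightarrow> int" where
  "theta_shift n r N = r * N - n * (N * (N + 1) div 2)"

text \<open>
  $z^{-N}$ times the following polynomial in $z$ is the truncated theta product
  $\prod_{j=1}^{N} (1 + z q^{n(j-1)+r}) (1 + z^{-1} q^{nj-r})$ up to the factor
  $q^e$ with $e$ given by \<^const>\<open>theta_shift\<close>.
\<close>

definition theta_poly :: "nat \<Rightarrow> int \<Rightarrow> nat \<Rightarrow> 'a::field fls poly" where
  "theta_poly n r N = (\<Prod>t<2 * N. [:1, fls_X powi (int n * (int t - int N) + r):])"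

lemma two_tri: "2 * (x * (x - 1) div 2) = x * (x - 1)" for x :: int
  by simp

lemma two_theta_exp: "2 * theta_exp n r x = n * (x * (x - 1)) + 2 * r * x"
  unfolding theta_exp_def distrib_left mult.left_commute[of 2 n] two_tri by simp

lemma two_theta_shift: "2 * theta_shift n r N = 2 * r * N - n * (N * (N + 1))"
  using two_tri[of "N + 1"]
  by (simp add: theta_shift_def right_diff_distrib mult.left_commute[of 2 n] mult.commute)

lemma fls_X_powi_add: "(fls_X :: 'a::field fls) powi (a + b) = fls_X powi a * fls_X powi b"
  by (rule power_int_add) simp

lemma fls_X_powi_nz: "(fls_X :: 'a::field fls) powi a \<noteq> 0"
  by simp

lemma fls_X_powi_sum: "(fls_X :: 'a::field fls) powi (sum f A) = (\<Prod>x\<in>A. fls_X powi f x)"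
  by (induction A rule: infinite_finite_induct) (auto simp: fls_X_powi_add simp del: fls_X_power_int)

lemma fls_X_powi_mult_nat: "((fls_X :: 'a::field fls) powi a) ^ k = fls_X powi (a * int k)"
  by (simp add: power_int_mult del: fls_X_power_int)

lemma coeff_theta_poly:
  assumes "n \<ge> 1" "k \<le> 2 * N"
  shows "coeff (theta_poly n r N :: 'a::field fls poly) k
    = gauss_binomial (fls_X ^ n) (2 * N) k
      * fls_X powi (theta_exp n r (int k - int N) + theta_shift n r N)"
proof -
  let ?p = "(fls_X :: 'a fls) ^ n" and ?w = "(fls_X :: 'a fls) powi (r - int n * int N)"
  have "fls_X powi (int n * (int t - int N) + r) = ?p ^ t * ?w" for t
  proof -
    have "fls_X powi (int n * (int t - int N) + r) = fls_X powi (int (n * t) + (r - int n * int N))"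
      by (rule arg_cong[of _ _ "\<lambda>e. fls_X powi e"]) (simp add: algebra_simps)
    also have "\<dots> = ?p ^ t * ?w"
      by (simp only: fls_X_powi_add power_int_of_nat power_mult)
    finally show ?thesis .
  qed
  then have "theta_poly n r N = (\<Prod>t<2 * N. [:1, ?p ^ t * ?w:])"
    by (simp add: theta_poly_def del: fls_X_power_int)
  then have "coeff (theta_poly n r N) k
      = gauss_binomial ?p (2 * N) k * (?p ^ (k * (k - 1) div 2) * ?w ^ k)"
    using assms by (simp add: q_binomial_coeff[OF euler_poly_nonzero] mult.assoc del: fls_X_power_int)
  also have "?p ^ (k * (k - 1) div 2) * ?w ^ k
      = fls_X powi (theta_exp n r (int k - int N) + theta_shift n r N)"
  proof -
    have ik: "2 * int (k * (k - 1) div 2) = int k * (int k - 1)"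
    proof -
      have "even (k * (k - 1))"
        by (cases k) auto
      then have "int (2 * (k * (k - 1) div 2)) = int (k * (k - 1))"
        by simp
      then show ?thesis
        by (cases k) (simp_all only: of_nat_mult of_nat_numeral, simp_all)
    qed
    have "2 * (int (n * (k * (k - 1) div 2)) + (r - int n * int N) * int k)
        = int n * (2 * int (k * (k - 1) div 2)) + 2 * (r - int n * int N) * int k"
      by simp
    also have "\<dots> = 2 * (theta_exp n r (int k - int N) + theta_shift n r N)"
      unfolding ik distrib_left[of 2 "theta_exp n r _"] two_theta_exp two_theta_shift by (simp add: algebra_simps)
    finally have eq: "int (n * (k * (k - 1) div 2)) + (r - int n * int N) * int k
        = theta_exp n r (int k - int N) + theta_shift n r N"
      by (rule mult_left_cancel[THEN iffD1, rotated]) simp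
    show ?thesis
      unfolding eq[symmetric]
      by (simp only: fls_X_powi_add power_int_of_nat power_mult fls_X_powi_mult_nat)
  qed
  finally show ?thesis .
qed

definition theta_coeff :: "nat \<Rightarrow> nat \<Rightarrow> int \<Rightarrow> 'a::field fls" where
  "theta_coeff n N x = gauss_binomial (fls_X ^ n) (2 * N) (nat (int N + x))"

lemma theta_poly_expand:
  assumes "n \<ge> 1"
  shows "theta_poly n r N = (\<Sum>x\<in>{- int N..int N}.
    monom (theta_coeff n N x * fls_X powi (theta_exp n r x + theta_shift n r N)) (nat (int N + x)))"
proof -
  let ?P = "theta_poly n r N :: 'a fls poly"
  have "degree [:1, c:] \<le> 1" for c :: "'a fls"
    by simp
  then have "degree ?P \<le> (\<Sum>t<2 * N. 1)"
    unfolding theta_poly_def by (intro degree_prod_sum_le[THEN order_trans] sum_mono) (auto simp del: fls_X_power_int)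
  then have "degree ?P \<le> 2 * N"
    by simp
  then have "?P = (\<Sum>k\<le>2 * N. monom (coeff ?P k) k)"
    by (simp add: poly_as_sum_of_monoms')
  also have "\<dots> = (\<Sum>k\<le>2 * N. monom (gauss_binomial (fls_X ^ n) (2 * N) k
      * fls_X powi (theta_exp n r (int k - int N) + theta_shift n r N)) k)"
    using coeff_theta_poly[OF assms] by (intro sum.cong) (auto simp del: fls_X_power_int)
  also have "\<dots> = (\<Sum>x\<in>{- int N..int N}.
    monom (theta_coeff n N x * fls_X powi (theta_exp n r x + theta_shift n r N)) (nat (int N + x)))"
    by (rule sum.reindex_bij_witness[of _ "\<lambda>x. nat (int N + x)" "\<lambda>k. int k - int N"])
      (auto simp: theta_coeff_def simp del: fls_X_power_int)
  finally show ?thesis .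
qed

lemma prod_theta_poly_residues:
  assumes "n \<ge> 1"
  shows "(\<Prod>r<n. theta_poly n (int r) N) = (theta_poly 1 0 (n * N) :: 'a::field fls poly)"
proof -
  let ?f = "\<lambda>s. [:1, (fls_X :: 'a fls) powi (int s - int (n * N)):]"
  have "(theta_poly 1 0 (n * N) :: 'a fls poly) = prod ?f {..<2 * N * n}"
    by (simp add: theta_poly_def mult_ac del: fls_X_power_int)
  also have "\<dots> = (\<Prod>t<2 * N. prod ?f {t * n..<t * n + n})"
    by (rule prod.nat_group[symmetric])
  also have "\<dots> = (\<Prod>t<2 * N. \<Prod>r<n. ?f (t * n + r))"
  proof (rule prod.cong[OF refl])
    fix t
    show "prod ?f {t * n..<t * n + n} = (\<Prod>r<n. ?f (t * n + r))"
      by (rule prod.reindex_bij_witness[of _ "\<lambda>r. t * n + r" "\<lambda>s. s - t * n"]) auto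
  qed
  also have "\<dots> = (\<Prod>r<n. \<Prod>t<2 * N. ?f (t * n + r))"
    by (rule prod.swap)
  also have "\<dots> = (\<Prod>r<n. theta_poly n (int r) N)"
    unfolding theta_poly_def by (intro prod.cong refl) (simp add: algebra_simps del: fls_X_power_int)
  finally show ?thesis ..
qed

lemma sum_theta_shift_residues:
  assumes "n \<ge> 1"
  shows "(\<Sum>r<n. theta_shift (int n) (int r) (int N)) = theta_shift 1 0 (int (n * N))"
proof -
  have gauss: "2 * (\<Sum>r<n. int r) = int n * (int n - 1)"
    by (induction n) (auto simp: algebra_simps)
  have "2 * (\<Sum>r<n. theta_shift (int n) (int r) (int N))
      = (\<Sum>r<n. 2 * int r * int N - int n * (int N * (int N + 1)))"
    unfolding sum_distrib_left two_theta_shift ..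
  also have "\<dots> = (2 * (\<Sum>r<n. int r)) * int N - int n * (int n * (int N * (int N + 1)))"
    by (simp add: sum_subtractf sum_distrib_left sum_distrib_right mult_ac)
  also have "\<dots> = 2 * theta_shift 1 0 (int (n * N))"
    unfolding gauss two_theta_shift by (simp add: algebra_simps)
  finally show ?thesis by simp
qed

lemma prod_monom: "(\<Prod>i\<in>A. monom (a i) (e i)) = monom (\<Prod>i\<in>A. a i) (\<Sum>i\<in>A. e i)"
  by (induction A rule: infinite_finite_induct) (auto simp: mult_monom)

lemma coeff_prod_theta_poly:
  assumes "finite I" "n \<ge> 1"
  shows "coeff (\<Prod>i\<in>I. theta_poly n (R i) N :: 'a::field fls poly) (N * card I)
    = (\<Sum>x | x \<in> I \<rightarrow>\<^sub>E {- int N..int N} \<and> sum x I = 0.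
        (\<Prod>i\<in>I. theta_coeff n N (x i)) * fls_X powi (\<Sum>i\<in>I. theta_exp n (R i) (x i)))
      * fls_X powi (\<Sum>i\<in>I. theta_shift n (R i) N)"
proof -
  let ?B = "I \<rightarrow>\<^sub>E {- int N..int N}"
  let ?c = "\<lambda>x. (\<Prod>i\<in>I. theta_coeff n N (x i)) * fls_X powi (\<Sum>i\<in>I. theta_exp n (R i) (x i))
      * fls_X powi (\<Sum>i\<in>I. theta_shift n (R i) N) :: 'a fls"
  have finB: "finite ?B"
    using assms by (intro finite_PiE) auto
  have sum_iff: "(\<Sum>i\<in>I. nat (int N + x i)) = N * card I \<longleftrightarrow> sum x I = 0" if "x \<in> ?B" for x
  proof -
    have "int (\<Sum>i\<in>I. nat (int N + x i)) = (\<Sum>i\<in>I. int N + x i)"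
      unfolding of_nat_sum using that by (intro sum.cong) (auto dest!: PiE_mem)
    also have "\<dots> = int (N * card I) + sum x I"
      by (simp add: sum.distrib)
    finally show ?thesis
      by linarith
  qed
  have "(\<Prod>i\<in>I. theta_poly n (R i) N :: 'a fls poly) = (\<Sum>x\<in>?B. monom (?c x) (\<Sum>i\<in>I. nat (int N + x i)))"
    unfolding theta_poly_expand[OF assms(2)]
    by (subst prod_sum_PiE) (use assms in \<open>auto simp: prod_monom prod.distrib fls_X_powi_sum fls_X_powi_add mult.assoc simp del: fls_X_power_int\<close>)
  then have "coeff (\<Prod>i\<in>I. theta_poly n (R i) N :: 'a fls poly) (N * card I)
      = (\<Sum>x\<in>?B. if (\<Sum>i\<in>I. nat (int N + x i)) = N * card I then ?c x else 0)"
    by (simp add: coeff_sum del: fls_X_power_int)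
  also have "\<dots> = (\<Sum>x\<in>?B. if sum x I = 0 then ?c x else 0)"
    by (intro sum.cong refl if_cong sum_iff)
  also have "\<dots> = sum ?c {x \<in> ?B. sum x I = 0}"
    using finB by (rule sum.inter_filter[symmetric])
  finally show ?thesis
    by (simp only: sum_distrib_right mem_Collect_eq)
qed

lemma coeff_theta_poly_mult:
  assumes "n \<ge> 1"
  shows "coeff (theta_poly n r N * theta_poly 1 0 (n * N) :: 'a::field fls poly) (N * Suc n)
    = (\<Sum>b\<in>{- int N..int N}. theta_coeff n N b * theta_coeff 1 (n * N) (- b)
        * fls_X powi (theta_exp n r b + theta_exp 1 0 (- b)))
      * fls_X powi (theta_shift n r N + theta_shift 1 0 (int (n * N)))"
proof -
  let ?P = "theta_poly 1 0 (n * N) :: 'a fls poly"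
  have "coeff (monom (theta_coeff n N b * fls_X powi (theta_exp n r b + theta_shift n r N)) (nat (int N + b)) * ?P) (N * Suc n)
      = theta_coeff n N b * theta_coeff 1 (n * N) (- b)
        * fls_X powi (theta_exp n r b + theta_exp 1 0 (- b))
        * fls_X powi (theta_shift n r N + theta_shift 1 0 (int (n * N)))"
    if b: "b \<in> {- int N..int N}" for b
  proof -
    define M where "M = n * N"
    have M: "N \<le> M" "N * Suc n = N + M"
      using assms by (auto simp: M_def)
    define k where "k = nat (int M + - b)"
    have k: "nat (int N + b) + k = N * Suc n" "k \<le> 2 * (n * N)" "int k - int (n * N) = - b"
      using b M(1) unfolding M(2) M_def[symmetric] k_def by auto
    have P: "coeff ?P k = theta_coeff 1 (n * N) (- b) * fls_X powi (theta_exp 1 0 (- b) + theta_shift 1 0 (int (n * N)))"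
      unfolding coeff_theta_poly[OF le_refl k(2)] k(3) by (simp add: theta_coeff_def k_def M_def)
    have "N * Suc n - nat (int N + b) = k" "\<not> N * Suc n < nat (int N + b)"
      using k(1) by linarith+
    then have monom: "coeff (monom c (nat (int N + b)) * ?P) (N * Suc n) = c * coeff ?P k" for c
      by (simp only: coeff_monom_mult if_False)
    show ?thesis
      unfolding monom P fls_X_powi_add by (simp only: mult_ac)
  qed
  then show ?thesis
    unfolding theta_poly_expand[OF assms, of r N] sum_distrib_right coeff_sum
    by (intro sum.cong refl) blast
qed

lemma finite_theta_identity:
  assumes "finite I" "i0 \<in> I" "bij_betw \<rho> (I - {i0}) {..<n}" "n \<ge> 1"
    and R: "R i0 = r" "\<And>i. i \<in> I - {i0} \<Longrightarrow> R i = int (\<rho> i)"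
  shows "(\<Sum>x | x \<in> I \<rightarrow>\<^sub>E {- int N..int N} \<and> sum x I = 0.
        (\<Prod>i\<in>I. theta_coeff n N (x i)) * fls_X powi (\<Sum>i\<in>I. theta_exp n (R i) (x i)))
    = (\<Sum>b\<in>{- int N..int N}. theta_coeff n N b * theta_coeff 1 (n * N) (- b)
        * (fls_X :: 'a::field fls) powi (theta_exp n r b + theta_exp 1 0 (- b)))"
    (is "?L = ?R")
proof -
  have card: "card I = Suc n"
    unfolding card.remove[OF assms(1,2)] bij_betw_same_card[OF assms(3)] by simp
  have "(\<Prod>i\<in>I. theta_poly n (R i) N :: 'a fls poly)
      = theta_poly n r N * (\<Prod>i\<in>I - {i0}. theta_poly n (int (\<rho> i)) N)"
    using assms(1,2) R by (simp add: prod.remove)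
  also have "(\<Prod>i\<in>I - {i0}. theta_poly n (int (\<rho> i)) N) = (\<Prod>j<n. theta_poly n (int j) N)"
    by (rule prod.reindex_bij_betw[OF assms(3)])
  finally have *: "(\<Prod>i\<in>I. theta_poly n (R i) N :: 'a fls poly)
      = theta_poly n r N * theta_poly 1 0 (n * N)"
    unfolding prod_theta_poly_residues[OF assms(4)] .
  have "(\<Sum>i\<in>I. theta_shift n (R i) N)
      = theta_shift n r N + (\<Sum>i\<in>I - {i0}. theta_shift n (int (\<rho> i)) N)"
    using assms(1,2) R by (simp add: sum.remove)
  also have "(\<Sum>i\<in>I - {i0}. theta_shift n (int (\<rho> i)) N) = (\<Sum>j<n. theta_shift n (int j) N)"
    by (rule sum.reindex_bij_betw[OF assms(3)])
  finally have shift: "(\<Sum>i\<in>I. theta_shift n (R i) N) = theta_shift n r N + theta_shift 1 0 (int (n * N))"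
    unfolding sum_theta_shift_residues[OF assms(4)] .
  have "?L * fls_X powi (theta_shift n r N + theta_shift 1 0 (int (n * N)))
      = ?R * fls_X powi (theta_shift n r N + theta_shift 1 0 (int (n * N)))"
    using arg_cong[OF *, of "\<lambda>p. coeff p (N * card I)"]
    unfolding coeff_theta_poly_mult[OF assms(4), folded card] coeff_prod_theta_poly[OF assms(1,4)] shift .
  then show ?thesis
    by (rule mult_right_cancel[THEN iffD1, rotated]) (rule fls_X_powi_nz)
qed

subsection \<open>Passage to the limit\<close>

lemma theta_exp_ge:
  assumes "0 \<le> r" "r < n"
  shows "\<bar>x\<bar> - 1 \<le> theta_exp n r x"
proof (cases "x \<ge> 1")
  case True
  have "0 \<le> (n - 1) * (x * (x - 1))"
    using True assms by (intro mult_nonneg_nonneg) auto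
  moreover have "0 \<le> (x - 1) * (x - 2)"
    using True by (cases "x = 1") (auto intro: mult_nonneg_nonneg)
  moreover have "0 \<le> 2 * r * x"
    using True assms by simp
  ultimately have "2 * (x - 1) \<le> 2 * theta_exp n r x"
    unfolding two_theta_exp by (simp add: algebra_simps)
  then show ?thesis
    using True by simp
next
  case False
  have "0 \<le> n * (x * (x + 1))"
  proof (cases "x = 0")
    case False
    then have "0 \<le> (- x) * (- x - 1)"
      using \<open>\<not> 1 \<le> x\<close> by (intro mult_nonneg_nonneg) auto
    also have "\<dots> = x * (x + 1)"
      by (simp add: algebra_simps)
    finally show ?thesis
      by (rule mult_nonneg_nonneg[rotated]) (use assms in simp)
  qed simp
  moreover have "0 \<le> (n - 1 - r) * (- x)"
    using False assms by (intro mult_nonneg_nonneg) auto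
  ultimately have "2 * (- x) \<le> 2 * theta_exp n r x"
    unfolding two_theta_exp by (simp add: algebra_simps)
  then show ?thesis
    using False by simp
qed

lemma theta_exp_levels_finite:
  assumes "0 \<le> r" "r < n"
  shows "finite {x \<in> A. theta_exp n r x \<le> M}"
proof (rule finite_subset)
  show "{x \<in> A. theta_exp n r x \<le> M} \<subseteq> {- (M + 1)..M + 1}"
  proof safe
    fix x assume "theta_exp n r x \<le> M"
    with theta_exp_ge[OF assms, of x] show "x \<in> {- (M + 1)..M + 1}"
      by auto
  qed
qed simp

lemma sum_theta_exp_ge:
  assumes "\<And>i. i \<in> I \<Longrightarrow> 0 \<le> R i \<and> R i < n"
  shows "(\<Sum>i\<in>I. \<bar>x i\<bar>) - int (card I) \<le> (\<Sum>i\<in>I. theta_exp n (R i) (x i))"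
proof -
  have "(\<Sum>i\<in>I. \<bar>x i\<bar> - 1) \<le> (\<Sum>i\<in>I. theta_exp n (R i) (x i))"
    using assms by (intro sum_mono theta_exp_ge) auto
  then show ?thesis
    by (simp add: sum_subtractf)
qed

lemma sum_theta_exp_ge_card:
  assumes "\<And>i. i \<in> I \<Longrightarrow> 0 \<le> R i \<and> R i < n"
  shows "- int (card I) \<le> (\<Sum>i\<in>I. theta_exp n (R i) (x i))"
proof -
  have "0 \<le> (\<Sum>i\<in>I. \<bar>x i\<bar>)"
    by (intro sum_nonneg) auto
  with sum_theta_exp_ge[of I R n x, OF assms] show ?thesis
    by linarith
qed

lemma sum_theta_exp_levels_finite:
  assumes "finite I" "\<And>i. i \<in> I \<Longrightarrow> 0 \<le> R i \<and> R i < n"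
    and "A \<subseteq> (I \<rightarrow>\<^sub>E UNIV)"
  shows "finite {x \<in> A. (\<Sum>i\<in>I. theta_exp n (R i) (x i)) \<le> M}"
proof (rule finite_subset)
  let ?b = "M + int (card I)"
  show "{x \<in> A. (\<Sum>i\<in>I. theta_exp n (R i) (x i)) \<le> M} \<subseteq> (I \<rightarrow>\<^sub>E {- ?b..?b})"
  proof
    fix x assume x: "x \<in> {x \<in> A. (\<Sum>i\<in>I. theta_exp n (R i) (x i)) \<le> M}"
    have "x i \<in> {- ?b..?b}" if "i \<in> I" for i
    proof -
      have "\<bar>x i\<bar> \<le> (\<Sum>i\<in>I. \<bar>x i\<bar>)"
        using that assms(1) by (intro member_le_sum) auto
      then have "\<bar>x i\<bar> \<le> ?b"
        using x sum_theta_exp_ge[of I R n x, OF assms(2)] by force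
      then show ?thesis by auto
    qed
    then show "x \<in> (I \<rightarrow>\<^sub>E {- ?b..?b})"
      using x assms(3) by (auto simp: PiE_iff subset_iff)
  qed
  show "finite (I \<rightarrow>\<^sub>E {- ?b..?b})"
    using assms(1) by (intro finite_PiE) auto
qed

lemma filterlim_finite_subsets_at_topI:
  assumes "\<And>N. finite (B N)" "\<And>N. B N \<subseteq> A" "\<And>x. x \<in> A \<Longrightarrow> \<forall>\<^sub>F N in F. x \<in> B N"
  shows "filterlim B (finite_subsets_at_top A) F"
  unfolding filterlim_finite_subsets_at_top
proof (intro allI impI)
  fix X assume X: "finite X \<and> X \<subseteq> A"
  then have "\<forall>\<^sub>F N in F. \<forall>x\<in>X. x \<in> B N"
    using assms(3) by (intro eventually_ball_finite) auto
  then show "\<forall>\<^sub>F N in F. finite (B N) \<and> X \<subseteq> B N \<and> B N \<subseteq> A"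
    by eventually_elim (use assms in auto)
qed

lemma filterlim_int_intervals:
  "filterlim (\<lambda>N. {- int N..int N}) (finite_subsets_at_top UNIV) sequentially"
proof (rule filterlim_finite_subsets_at_topI)
  fix x :: int
  show "\<forall>\<^sub>F N in sequentially. x \<in> {- int N..int N}"
    using eventually_ge_at_top[of "nat \<bar>x\<bar>"] by eventually_elim auto
qed auto

lemma filterlim_int_boxes:
  assumes "finite I"
  shows "filterlim (\<lambda>N. {x. x \<in> I \<rightarrow>\<^sub>E {- int N..int N} \<and> P x})
    (finite_subsets_at_top {x. x \<in> I \<rightarrow>\<^sub>E UNIV \<and> P x}) sequentially"
proof (rule filterlim_finite_subsets_at_topI)
  show "finite {x. x \<in> I \<rightarrow>\<^sub>E {- int N..int N} \<and> P x}" for N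
    using assms by (intro finite_Collect_conjI disjI1) (simp add: finite_PiE)
  show "{x. x \<in> I \<rightarrow>\<^sub>E {- int N..int N} \<and> P x} \<subseteq> {x. x \<in> I \<rightarrow>\<^sub>E UNIV \<and> P x}" for N
    by (auto simp: PiE_iff)
  fix x :: "'a \<Rightarrow> int" assume x: "x \<in> {x. x \<in> I \<rightarrow>\<^sub>E UNIV \<and> P x}"
  have "\<forall>\<^sub>F N in sequentially. x i \<in> {- int N..int N}" for i
    using eventually_ge_at_top[of "nat \<bar>x i\<bar>"] by eventually_elim auto
  then have "\<forall>\<^sub>F N in sequentially. \<forall>i\<in>I. x i \<in> {- int N..int N}"
    using assms by (intro eventually_ball_finite) auto
  then show "\<forall>\<^sub>F N in sequentially. x \<in> {x. x \<in> I \<rightarrow>\<^sub>E {- int N..int N} \<and> P x}"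
    by eventually_elim (use x in \<open>auto simp: PiE_iff\<close>)
qed

lemma order_ge_theta_coeff:
  assumes "n \<ge> 1"
  shows "order_ge 0 (theta_coeff n N x :: 'a::field fls)"
  unfolding theta_coeff_def gauss_binomial_def order_ge_iff_subdegree
  by (simp add: fls_divide_subdegree fls_subdegree_euler_poly[OF assms] euler_poly_nonzero[OF assms])

lemma tendsto_theta_coeff:
  assumes "n \<ge> 1"
  shows "(\<lambda>N. theta_coeff n N x :: 'a::field fls) \<longlonglongrightarrow> inverse (euler_phi (fls_X ^ n))"
proof -
  let ?p = "(fls_X :: 'a fls) ^ n"
  have "filterlim (\<lambda>N. 2 * N) sequentially sequentially"
    by (rule filterlim_subseq) (simp add: strict_mono_def)
  then have 1: "(\<lambda>N. euler_poly (2 * N) ?p) \<longlonglongrightarrow> euler_phi ?p"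
    by (rule filterlim_compose[OF tendsto_euler_phi[OF assms]])
  have "filterlim (\<lambda>N. nat (int N + y)) sequentially sequentially" for y
    unfolding filterlim_at_top
  proof
    fix Z
    show "\<forall>\<^sub>F N in sequentially. Z \<le> nat (int N + y)"
      using eventually_ge_at_top[of "Z + nat \<bar>y\<bar>"] by eventually_elim linarith
  qed
  then have 2: "(\<lambda>N. euler_poly (nat (int N + y)) ?p) \<longlonglongrightarrow> euler_phi ?p" for y
    by (rule filterlim_compose[OF tendsto_euler_phi[OF assms]])
  have "(\<lambda>N. euler_poly (2 * N) ?p / (euler_poly (nat (int N + x)) ?p * euler_poly (nat (int N + - x)) ?p))
      \<longlonglongrightarrow> euler_phi ?p / (euler_phi ?p * euler_phi ?p)"
    by (intro tendsto_divide_fls tendsto_mult_fls 1 2) (simp add: euler_phi_nonzero[OF assms])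
  moreover have "\<forall>\<^sub>F N in sequentially. euler_poly (2 * N) ?p
      / (euler_poly (nat (int N + x)) ?p * euler_poly (nat (int N + - x)) ?p) = theta_coeff n N x"
    using eventually_ge_at_top[of "nat \<bar>x\<bar>"]
  proof eventually_elim
    case (elim N)
    then have "nat (int N + - x) = 2 * N - nat (int N + x)"
      by linarith
    then show ?case
      by (simp add: theta_coeff_def gauss_binomial_def)
  qed
  ultimately have "(\<lambda>N. theta_coeff n N x :: 'a fls) \<longlonglongrightarrow> euler_phi ?p / (euler_phi ?p * euler_phi ?p)"
    by (rule Lim_transform_eventually)
  moreover have "a / (a * a) = inverse a" if "a \<noteq> 0" for a :: "'a fls"
    using that by (simp add: field_simps)
  ultimately show ?thesis
    using euler_phi_nonzero[OF assms, where 'a = 'a] by simp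
qed

lemma order_ge_inverse_euler_phi:
  assumes "n \<ge> 1"
  shows "order_ge 0 (inverse (euler_phi ((fls_X :: 'a::field fls) ^ n)))"
  using fls_subdegree_euler_phi[OF assms, where 'a = 'a] euler_phi_nonzero[OF assms, where 'a = 'a]
  by (simp add: order_ge_iff_subdegree)

lemma tendsto_lattice_sum:
  assumes I: "finite I" and n: "n \<ge> 1" and R: "\<And>i. i \<in> I \<Longrightarrow> 0 \<le> R i \<and> R i < int n"
    and S: "((\<lambda>x. fls_X powi (\<Sum>i\<in>I. theta_exp n (R i) (x i))) has_sum S)
        {x. x \<in> I \<rightarrow>\<^sub>E UNIV \<and> sum x I = 0}"
  shows "(\<lambda>N. \<Sum>x | x \<in> I \<rightarrow>\<^sub>E {- int N..int N} \<and> sum x I = 0.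
        (\<Prod>i\<in>I. theta_coeff n N (x i)) * fls_X powi (\<Sum>i\<in>I. theta_exp n (R i) (x i)))
    \<longlonglongrightarrow> inverse (euler_phi ((fls_X :: 'a::field fls) ^ n)) ^ card I * S"
proof (rule tendsto_weighted_sum[OF S])
  show "- int (card I) \<le> (\<Sum>i\<in>I. theta_exp n (R i) (x i))" for x
    by (rule sum_theta_exp_ge_card[OF R])
  show "finite {x \<in> {x. x \<in> I \<rightarrow>\<^sub>E UNIV \<and> sum x I = 0}. (\<Sum>i\<in>I. theta_exp n (R i) (x i)) \<le> M}" for M
    by (rule sum_theta_exp_levels_finite[OF I R]) auto
  show "filterlim (\<lambda>N. {x. x \<in> I \<rightarrow>\<^sub>E {- int N..int N} \<and> sum x I = 0})
      (finite_subsets_at_top {x. x \<in> I \<rightarrow>\<^sub>E UNIV \<and> sum x I = 0}) sequentially"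
    by (rule filterlim_int_boxes[OF I])
  show "(\<lambda>N. \<Prod>i\<in>I. theta_coeff n N (x i) :: 'a fls) \<longlonglongrightarrow> inverse (euler_phi (fls_X ^ n)) ^ card I" for x
    unfolding prod_constant[symmetric] by (intro tendsto_prod_fls tendsto_theta_coeff n)
  show "order_ge 0 (\<Prod>i\<in>I. theta_coeff n N (x i) :: 'a fls)" for N x
    by (intro order_ge_prod_0 order_ge_theta_coeff n)
  show "order_ge 0 (inverse (euler_phi ((fls_X :: 'a fls) ^ n)) ^ card I)"
    using order_ge_prod_0[of I "\<lambda>_. inverse (euler_phi ((fls_X :: 'a fls) ^ n))"]
      order_ge_inverse_euler_phi[OF n] by simp
qed

lemma lattice_sum_summable:
  assumes I: "finite I" and R: "\<And>i. i \<in> I \<Longrightarrow> 0 \<le> R i \<and> R i < n"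
  shows "\<exists>S. ((\<lambda>x. (fls_X :: 'a::field fls) powi (\<Sum>i\<in>I. theta_exp n (R i) (x i))) has_sum S)
        {x. x \<in> I \<rightarrow>\<^sub>E UNIV \<and> sum x I = 0}"
proof (rule has_sum_X_powi_exists)
  show "- int (card I) \<le> (\<Sum>i\<in>I. theta_exp n (R i) (x i))" for x
    by (rule sum_theta_exp_ge_card[OF R])
  show "finite {x \<in> {x. x \<in> I \<rightarrow>\<^sub>E UNIV \<and> sum x I = 0}. (\<Sum>i\<in>I. theta_exp n (R i) (x i)) \<le> M}" for M
    by (rule sum_theta_exp_levels_finite[OF I R]) auto
qed

subsection \<open>The one-dimensional theta series\<close>

lemma euler_poly_odd_factors:
  fixes Q :: "'a::comm_ring_1"
  shows "(\<Prod>i<K. 1 + Q ^ (2 * i + 1)) * (euler_poly (2 * K) Q * euler_poly K (Q ^ 4))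
    = euler_poly (2 * K) (Q ^ 2) * euler_poly K (Q ^ 2)"
proof (induction K)
  case (Suc K)
  define a b where "a = Q ^ (2 * K + 1)" and "b = Q ^ (2 * K + 2)"
  have pow: "Q ^ Suc (2 * K) = a" "Q ^ Suc (Suc (2 * K)) = b" "(Q ^ 4) ^ Suc K = b ^ 2"
    "(Q ^ 2) ^ Suc (2 * K) = a ^ 2" "(Q ^ 2) ^ Suc (Suc (2 * K)) = b ^ 2" "(Q ^ 2) ^ Suc K = b"
    unfolding a_def b_def power_mult[symmetric] by (rule arg_cong[of _ _ "power Q"], simp)+
  have "(\<Prod>i<Suc K. 1 + Q ^ (2 * i + 1)) * (euler_poly (2 * Suc K) Q * euler_poly (Suc K) (Q ^ 4))
      = ((\<Prod>i<K. 1 + Q ^ (2 * i + 1)) * (euler_poly (2 * K) Q * euler_poly K (Q ^ 4)))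
        * ((1 + a) * (1 - a) * (1 - b) * (1 - b ^ 2))"
    unfolding mult_Suc_right add_2_eq_Suc euler_poly_Suc pow prod.lessThan_Suc
    by (simp add: a_def mult_ac)
  also have "\<dots> = euler_poly (2 * K) (Q ^ 2) * euler_poly K (Q ^ 2) * ((1 - a ^ 2) * (1 - b ^ 2) * (1 - b))"
    unfolding Suc.IH by (simp add: algebra_simps power2_eq_square)
  also have "\<dots> = euler_poly (2 * Suc K) (Q ^ 2) * euler_poly (Suc K) (Q ^ 2)"
    unfolding mult_Suc_right add_2_eq_Suc euler_poly_Suc pow by (simp add: mult_ac)
  finally show ?case .
qed simp

lemma poly_theta_poly_1:
  "poly (theta_poly (4 * m) (3 * int m) N) 1
    = fls_X powi theta_shift (4 * int m) (3 * int m) (int N)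
      * (\<Prod>i<2 * N. 1 + ((fls_X :: 'a::field fls) ^ m) ^ (2 * i + 1))"
proof (induction N)
  case 0
  then show ?case
    by (simp add: theta_poly_def theta_shift_def)
next
  case (Suc N)
  let ?X = "fls_X :: 'a fls"
  define g where "g N t = 1 + ?X powi (4 * int m * (int t - int N) + 3 * int m)" for N t
  have poly: "poly (theta_poly (4 * m) (3 * int m) N) 1 = (\<Prod>t<2 * N. g N t)" for N
    by (simp add: theta_poly_def g_def poly_prod del: fls_X_power_int)
  have shift: "theta_shift (4 * int m) (3 * int m) (int (Suc N))
      = theta_shift (4 * int m) (3 * int m) (int N) + - int (m * (2 * (2 * N) + 1))"
  proof -
    have "2 * theta_shift (4 * int m) (3 * int m) (int (Suc N))
        = 2 * (theta_shift (4 * int m) (3 * int m) (int N) + - int (m * (2 * (2 * N) + 1)))"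
      unfolding distrib_left[of 2 "theta_shift _ _ _"] two_theta_shift by (simp add: algebra_simps)
    then show ?thesis
      by (rule mult_left_cancel[THEN iffD1, rotated]) simp
  qed
  have e: "4 * int m * (int 0 - int (Suc N)) + 3 * int m = - int (m * (2 * (2 * N) + 1))"
    "4 * int m * (int (Suc (2 * N)) - int (Suc N)) + 3 * int m = int (m * (2 * Suc (2 * N) + 1))"
    by (simp_all add: algebra_simps)
  have first: "g (Suc N) 0 = ?X powi (- int (m * (2 * (2 * N) + 1))) * (1 + (?X ^ m) ^ (2 * (2 * N) + 1))"
  proof -
    have "?X powi (- int (m * (2 * (2 * N) + 1))) * (1 + ?X powi int (m * (2 * (2 * N) + 1)))
        = ?X powi (- int (m * (2 * (2 * N) + 1))) + ?X powi (- int (m * (2 * (2 * N) + 1)) + int (m * (2 * (2 * N) + 1)))"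
      by (simp only: distrib_left mult_1_right fls_X_powi_add)
    also have "\<dots> = g (Suc N) 0"
      unfolding g_def e by simp
    finally show ?thesis
      unfolding power_int_of_nat power_mult ..
  qed
  have last: "g (Suc N) (Suc (2 * N)) = 1 + (?X ^ m) ^ (2 * Suc (2 * N) + 1)"
    unfolding g_def e power_int_of_nat power_mult ..
  have middle: "g (Suc N) (Suc t) = g N t" for t
    by (simp add: g_def)
  have "(\<Prod>t<2 * Suc N. g (Suc N) t) = g (Suc N) 0 * ((\<Prod>t<2 * N. g N t) * g (Suc N) (Suc (2 * N)))"
    unfolding mult_Suc_right add_2_eq_Suc prod.lessThan_Suc_shift[of _ "Suc (2 * N)"] o_def
      prod.lessThan_Suc[of _ "2 * N"] middle ..
  then show ?case
    unfolding poly Suc.IH[unfolded poly] first last shift fls_X_powi_add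
      mult_Suc_right[of 2 N] add_2_eq_Suc prod.lessThan_Suc
    by (simp only: mult_ac)
qed

lemma sum_theta_coeff_eq_prod:
  assumes "m \<ge> 1"
  shows "(\<Sum>b\<in>{- int N..int N}. theta_coeff (4 * m) N b * fls_X powi theta_exp (4 * int m) (3 * int m) b)
    = (\<Prod>i<2 * N. 1 + ((fls_X :: 'a::field fls) ^ m) ^ (2 * i + 1))"
    (is "?L = ?R")
proof -
  let ?s = "fls_X powi theta_shift (4 * int m) (3 * int m) (int N) :: 'a fls"
  have n: "4 * m \<ge> 1" "int (4 * m) = 4 * int m"
    using assms by simp_all
  have "?s * ?L = poly (theta_poly (4 * m) (3 * int m) N) 1"
    unfolding theta_poly_expand[OF n(1)] poly_sum poly_monom n(2) fls_X_powi_add power_one mult_1_right sum_distrib_left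
    by (simp only: mult_ac)
  also have "\<dots> = ?s * ?R"
    by (rule poly_theta_poly_1)
  finally show ?thesis
    by (rule mult_left_cancel[THEN iffD1, rotated]) (rule fls_X_powi_nz)
qed

lemma filterlim_mult_nat:
  assumes "(c::nat) \<ge> 1"
  shows "filterlim (\<lambda>N. c * N) sequentially sequentially"
  using assms by (intro filterlim_subseq) (simp add: strict_mono_def)

lemma has_sum_theta_special:
  assumes m: "m \<ge> 1"
  obtains W where "((\<lambda>b. (fls_X :: 'a::field fls) powi theta_exp (4 * int m) (3 * int m) b) has_sum W) UNIV"
    and "W * euler_phi (fls_X ^ m) = euler_phi (fls_X ^ (2 * m)) ^ 2"
proof -
  let ?X = "fls_X :: 'a fls"
  have r: "0 \<le> 3 * int m" "3 * int m < 4 * int m"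
    using m by simp_all
  have ge: "- 1 \<le> theta_exp (4 * int m) (3 * int m) b" for b
    using theta_exp_ge[OF r, of b] by linarith
  obtain W where W: "((\<lambda>b. ?X powi theta_exp (4 * int m) (3 * int m) b) has_sum W) UNIV"
    using has_sum_X_powi_exists[of UNIV "- 1" "theta_exp (4 * int m) (3 * int m)"] ge theta_exp_levels_finite[OF r]
    by blast
  have pos: "4 * m \<ge> 1" "2 * m \<ge> 1"
    using m by simp_all
  have 1: "(\<lambda>N. \<Sum>b\<in>{- int N..int N}. theta_coeff (4 * m) N b * ?X powi theta_exp (4 * int m) (3 * int m) b)
      \<longlonglongrightarrow> inverse (euler_phi (?X ^ (4 * m))) * W"
    by (rule tendsto_weighted_sum[OF W ge theta_exp_levels_finite[OF r] filterlim_int_intervals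
          tendsto_theta_coeff[OF pos(1)] order_ge_theta_coeff[OF pos(1)] order_ge_inverse_euler_phi[OF pos(1)]])
  have E: "(\<lambda>N. euler_poly (c * N) (?X ^ d)) \<longlonglongrightarrow> euler_phi (?X ^ d)" if "c \<ge> 1" "d \<ge> 1" for c d
    by (rule filterlim_compose[OF tendsto_euler_phi[OF that(2)] filterlim_mult_nat[OF that(1)]])
  have Q: "(?X ^ m) ^ 2 = ?X ^ (2 * m)" "(?X ^ m) ^ 4 = ?X ^ (4 * m)"
    by (simp_all add: power_mult[symmetric] mult.commute)
  have "(\<lambda>N. (\<Sum>b\<in>{- int N..int N}. theta_coeff (4 * m) N b * ?X powi theta_exp (4 * int m) (3 * int m) b)
      * (euler_poly (4 * N) (?X ^ m) * euler_poly (2 * N) (?X ^ (4 * m))))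
      \<longlonglongrightarrow> inverse (euler_phi (?X ^ (4 * m))) * W * (euler_phi (?X ^ m) * euler_phi (?X ^ (4 * m)))"
    by (intro tendsto_mult_fls 1 E m pos) simp_all
  moreover have "(\<Sum>b\<in>{- int N..int N}. theta_coeff (4 * m) N b * ?X powi theta_exp (4 * int m) (3 * int m) b)
      * (euler_poly (4 * N) (?X ^ m) * euler_poly (2 * N) (?X ^ (4 * m)))
      = euler_poly (4 * N) (?X ^ (2 * m)) * euler_poly (2 * N) (?X ^ (2 * m))" for N
    unfolding sum_theta_coeff_eq_prod[OF m] using euler_poly_odd_factors[of "?X ^ m" "2 * N"]
    unfolding Q by (simp add: mult.assoc[symmetric])
  moreover have "(\<lambda>N. euler_poly (4 * N) (?X ^ (2 * m)) * euler_poly (2 * N) (?X ^ (2 * m)))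
      \<longlonglongrightarrow> euler_phi (?X ^ (2 * m)) * euler_phi (?X ^ (2 * m))"
    by (intro tendsto_mult_fls E pos) simp_all
  ultimately have "inverse (euler_phi (?X ^ (4 * m))) * W * (euler_phi (?X ^ m) * euler_phi (?X ^ (4 * m)))
      = euler_phi (?X ^ (2 * m)) * euler_phi (?X ^ (2 * m))"
    using LIMSEQ_unique by (simp only:) blast
  moreover have "inverse a * W * (c * a) = W * c" if "a \<noteq> 0" for a c :: "'a fls"
    using that by (simp add: field_simps)
  ultimately have "W * euler_phi (?X ^ m) = euler_phi (?X ^ (2 * m)) ^ 2"
    using euler_phi_nonzero[OF pos(1), where 'a = 'a] by (simp add: power2_eq_square)
  with W show thesis
    by (rule that)
qed

subsection \<open>The lattice sum\<close>

definition root_residue :: "nat \<Rightarrow> nat \<Rightarrow> nat" where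
  "root_residue m i = (if i \<le> 3 * m then i + m - 2 else i - 3 * m - 1)"

definition root_offset :: "nat \<Rightarrow> nat \<Rightarrow> int" where
  "root_offset m i = (if i = 1 then 3 * int m - 1 else int (root_residue m i))"

lemma bij_betw_root_residue:
  assumes "m \<ge> 1"
  shows "bij_betw (root_residue m) ({1..4 * m} - {1}) {..<4 * m - 1}"
  by (rule bij_betwI[where g = "\<lambda>j. if j < m then j + 3 * m + 1 else j + 2 - m"])
    (use assms in \<open>auto simp: root_residue_def split: if_splits\<close>)

lemma has_sum_root_lattice:
  assumes m: "m \<ge> 1"
  shows "((\<lambda>x. (fls_X :: 'a::field fls) powi (\<Sum>i\<in>{1..4 * m}. theta_exp (4 * int m - 1) (root_offset m i) (x i)))
    has_sum (euler_phi (fls_X ^ (4 * m - 1)) ^ (4 * m - 1) * euler_phi (fls_X ^ (2 * m)) ^ 2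
             / (euler_phi fls_X * euler_phi (fls_X ^ m))))
    {x. x \<in> {1..4 * m} \<rightarrow>\<^sub>E UNIV \<and> sum x {1..4 * m} = 0}"
proof -
  let ?X = "fls_X :: 'a fls"
  define n where "n = 4 * m - 1"
  have n: "n \<ge> 1" "int n = 4 * int m - 1" "4 * m = Suc n"
    using m by (auto simp: n_def)
  let ?I = "{1..4 * m}"
  let ?P = "euler_phi (?X ^ n)"
  let ?\<phi> = "euler_phi (?X ^ 1)"
  have R: "0 \<le> root_offset m i \<and> root_offset m i < int n" if "i \<in> ?I" for i
    using that m by (auto simp: root_offset_def root_residue_def n(2))
  have I: "finite ?I" "1 \<in> ?I"
    using m by auto
  obtain S where S: "((\<lambda>x. ?X powi (\<Sum>i\<in>?I. theta_exp n (root_offset m i) (x i))) has_sum S)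
      {x. x \<in> ?I \<rightarrow>\<^sub>E UNIV \<and> sum x ?I = 0}"
    using lattice_sum_summable[OF I(1), of "root_offset m" "int n"] R by blast
  obtain W where W: "((\<lambda>b. ?X powi theta_exp (4 * int m) (3 * int m) b) has_sum W) UNIV"
    and W_eq: "W * euler_phi (?X ^ m) = euler_phi (?X ^ (2 * m)) ^ 2"
    using has_sum_theta_special[OF m] by blast
  have "theta_exp n (3 * int m - 1) b + theta_exp 1 0 (- b) = theta_exp (4 * int m) (3 * int m) b" for b
  proof -
    have "2 * (theta_exp n (3 * int m - 1) b + theta_exp 1 0 (- b)) = 2 * theta_exp (4 * int m) (3 * int m) b"
      unfolding distrib_left[of 2 "theta_exp _ _ _"] two_theta_exp n(2) by (simp add: algebra_simps)
    then show ?thesis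
      by (rule mult_left_cancel[THEN iffD1, rotated]) simp
  qed
  then have identity: "(\<Sum>x | x \<in> ?I \<rightarrow>\<^sub>E {- int N..int N} \<and> sum x ?I = 0.
        (\<Prod>i\<in>?I. theta_coeff n N (x i)) * ?X powi (\<Sum>i\<in>?I. theta_exp n (root_offset m i) (x i)))
      = (\<Sum>b\<in>{- int N..int N}. theta_coeff n N b * theta_coeff 1 (n * N) (- b)
        * ?X powi theta_exp (4 * int m) (3 * int m) b)" for N
    using finite_theta_identity[OF I bij_betw_root_residue[OF m, folded n_def] n(1),
        of "root_offset m" "3 * int m - 1" N, where 'a = 'a]
    by (simp add: root_offset_def del: fls_X_power_int)
  have r: "0 \<le> 3 * int m" "3 * int m < 4 * int m"
    using m by simp_all
  have ge: "- 1 \<le> theta_exp (4 * int m) (3 * int m) b" for b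
    using theta_exp_ge[OF r, of b] by linarith
  have "(\<lambda>N. \<Sum>x | x \<in> ?I \<rightarrow>\<^sub>E {- int N..int N} \<and> sum x ?I = 0.
        (\<Prod>i\<in>?I. theta_coeff n N (x i)) * ?X powi (\<Sum>i\<in>?I. theta_exp n (root_offset m i) (x i)))
      \<longlonglongrightarrow> (inverse ?P * inverse ?\<phi>) * W"
    unfolding identity
  proof (rule tendsto_weighted_sum[OF W ge theta_exp_levels_finite[OF r] filterlim_int_intervals])
    show "(\<lambda>N. theta_coeff n N b * theta_coeff 1 (n * N) (- b)) \<longlonglongrightarrow> inverse ?P * inverse ?\<phi>" for b
      by (intro tendsto_mult_fls tendsto_theta_coeff n(1)
          filterlim_compose[OF tendsto_theta_coeff[OF le_refl] filterlim_mult_nat[OF n(1)]])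
    show "order_ge 0 (theta_coeff n N b * theta_coeff 1 (n * N) (- b) :: 'a fls)" for N b
      by (intro order_ge_mult_0 order_ge_theta_coeff n(1) le_refl)
    show "order_ge 0 (inverse ?P * inverse ?\<phi>)"
      by (intro order_ge_mult_0 order_ge_inverse_euler_phi n(1) le_refl)
  qed
  from LIMSEQ_unique[OF tendsto_lattice_sum[OF I(1) n(1) R S] this]
  have "inverse ?P ^ Suc n * S = inverse ?P * inverse ?\<phi> * W"
    by (simp add: n(3))
  moreover have "?P \<noteq> 0" "?\<phi> \<noteq> 0" "euler_phi (?X ^ m) \<noteq> 0"
    by (rule euler_phi_nonzero, use n(1) m in simp)+
  moreover have "S = a ^ n * (W * c) / (b * c)"
    if "inverse a ^ Suc n * S = inverse a * inverse b * W" "a \<noteq> 0" "b \<noteq> 0" "c \<noteq> 0" for a b c :: "'a fls"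
  proof -
    have "a ^ Suc n * inverse a ^ Suc n = 1"
      unfolding power_mult_distrib[symmetric] using that(2) by simp
    then have "S = a ^ Suc n * (inverse a ^ Suc n * S)"
      unfolding mult.assoc[symmetric] by simp
    then show ?thesis
      unfolding that(1) using that(2-) by (simp add: field_simps)
  qed
  ultimately have "S = ?P ^ n * (W * euler_phi (?X ^ m)) / (?\<phi> * euler_phi (?X ^ m))"
    by blast
  with S show ?thesis
    unfolding W_eq n_def[symmetric] n(2) by simp
qed

lemma sum_square_differences:
  fixes K :: "nat \<Rightarrow> int"
  assumes "K 0 = 0"
  shows "(\<Sum>i=1..L. (K i - K (i - 1))\<^sup>2) = 2 * kappa L K - (K L)\<^sup>2"
proof (induction L)
  case (Suc L)
  have "{1..<Suc L} = (if L = 0 then {} else insert L {1..<L})"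
    by auto
  then have "(\<Sum>i=1..<Suc L. K i * K (i + 1)) = (\<Sum>i=1..<L. K i * K (i + 1)) + K L * K (Suc L)"
    using assms by auto
  then have "kappa (Suc L) K = kappa L K + (K (Suc L))\<^sup>2 - K L * K (Suc L)"
    by (simp add: kappa_def)
  then show ?case
    using Suc by (simp add: power2_diff algebra_simps)
qed (simp add: kappa_def assms)

lemma sum_mult_differences:
  fixes K R :: "nat \<Rightarrow> int"
  assumes "K 0 = 0"
  shows "(\<Sum>i=1..Suc L. R i * (K i - K (i - 1))) = R (Suc L) * K (Suc L) + (\<Sum>i=1..L. (R i - R (Suc i)) * K i)"
  by (induction L) (auto simp: assms algebra_simps)

lemma sum_theta_exp_differences:
  fixes K :: "nat \<Rightarrow> int"
  assumes m: "m \<ge> 1" and K: "K 0 = 0" "K (4 * m) = 0"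
  shows "(\<Sum>i\<in>{1..4 * m}. theta_exp (4 * int m - 1) (root_offset m i) (K i - K (i - 1)))
    = (4 * int m - 1) * kappa (4 * m - 1) K + lin m K"
proof -
  define l where "l = 4 * m - 1"
  have l: "4 * m = Suc l"
    using m by (simp add: l_def)
  let ?R = "root_offset m"
  let ?x = "\<lambda>i. K i - K (i - 1)"
  let ?c = "\<lambda>i. if i = 1 then 2 * int m - 1 else if i = 3 * m then 4 * int m - 2 else - 1"
  have sum_x: "(\<Sum>i=1..Suc l. ?x i) = 0"
    using K sum_telescope''[of 0 "Suc l" K] l by (simp add: atLeastSucAtMost_greaterThanAtMost del: sum.cl_ivl_Suc)
  have sum_sq: "(\<Sum>i=1..Suc l. (?x i)\<^sup>2) = 2 * kappa l K"
    using sum_square_differences[where K = K and L = l, OF K(1)] K(2) l by simp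
  have "(\<Sum>i=1..Suc l. ?R i * ?x i) = (\<Sum>i=1..l. (?R i - ?R (Suc i)) * K i)"
    using sum_mult_differences[where K = K and R = ?R and L = l, OF K(1)] K(2) l by simp
  also have "\<dots> = (\<Sum>i\<in>{1..l}. ?c i * K i)"
    by (intro sum.cong refl arg_cong2[of _ _ _ _ "(*)"])
      (use m in \<open>auto simp: root_offset_def root_residue_def l_def\<close>)
  also have "\<dots> = ?c 1 * K 1 + (\<Sum>i\<in>{1..l} - {1}. ?c i * K i)"
    by (rule sum.remove) (use m in \<open>auto simp: l_def\<close>)
  also have "(\<Sum>i\<in>{1..l} - {1}. ?c i * K i)
      = ?c (3 * m) * K (3 * m) + (\<Sum>i\<in>{1..l} - {1} - {3 * m}. ?c i * K i)"
    by (rule sum.remove) (use m in \<open>auto simp: l_def\<close>)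
  also have "(\<Sum>i\<in>{1..l} - {1} - {3 * m}. ?c i * K i) = (\<Sum>i\<in>{1..l} - {1} - {3 * m}. - K i)"
    by (intro sum.cong refl) simp
  also have "{1..l} - {1} - {3 * m} = {2..4 * m - 1} - {3 * m}"
    by (auto simp: l_def)
  finally have sum_R: "(\<Sum>i=1..Suc l. ?R i * ?x i) = lin m K"
    using m by (simp add: lin_def sum_negf)
  have linear: "(\<Sum>i\<in>A. a * f i - a * g i + 2 * h i) = a * sum f A - a * sum g A + 2 * sum h A"
    for A :: "nat set" and a :: int and f g h
    by (simp add: sum.distrib sum_subtractf sum_distrib_left)
  have "2 * (\<Sum>i=1..Suc l. theta_exp (4 * int m - 1) (?R i) (?x i))
      = (\<Sum>i=1..Suc l. (4 * int m - 1) * (?x i)\<^sup>2 - (4 * int m - 1) * ?x i + 2 * (?R i * ?x i))"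
    unfolding sum_distrib_left two_theta_exp by (intro sum.cong refl) (simp add: algebra_simps power2_eq_square)
  also have "\<dots> = (4 * int m - 1) * (\<Sum>i=1..Suc l. (?x i)\<^sup>2) - (4 * int m - 1) * (\<Sum>i=1..Suc l. ?x i)
      + 2 * (\<Sum>i=1..Suc l. ?R i * ?x i)"
    by (rule linear)
  also have "\<dots> = 2 * ((4 * int m - 1) * kappa l K + lin m K)"
    unfolding sum_x sum_sq sum_R by simp
  finally show ?thesis
    unfolding l l_def[symmetric] by (simp del: sum.cl_ivl_Suc)
qed

theorem theorem6p1:
  fixes m :: nat and q :: "rat fls"
  assumes "m \<ge> 1"
  defines "q \<equiv> fls_X"
  shows "((\<lambda>k. q powi ((4 * int m - 1) * kappa (4 * m - 1) k + lin m k)) has_sum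
           (euler_phi (q ^ (4 * m - 1)) ^ (4 * m - 1) * euler_phi (q ^ (2 * m)) ^ 2
             / (euler_phi q * euler_phi (q ^ m))))
         (int_tuples (4 * m - 1))"
proof -
  define l where "l = 4 * m - 1"
  have l: "4 * m = Suc l"
    using assms by (simp add: l_def)
  define ext where "ext k i = (if i \<in> {1..l} then k i else 0)" for k :: "nat \<Rightarrow> int" and i
  define diffs where "diffs k = restrict (\<lambda>i. ext k i - ext k (i - 1)) {1..Suc l}" for k
  define psums where "psums x = restrict (\<lambda>i. \<Sum>j=1..i. x j) {1..l}" for x :: "nat \<Rightarrow> int"
  have tele: "(\<Sum>j=1..i. ext k j - ext k (j - 1)) = ext k i" for k i
    by (induction i) (auto simp: ext_def)
  have exponent: "(\<Sum>i\<in>{1..4 * m}. theta_exp (4 * int m - 1) (root_offset m i) (diffs k i))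
      = (4 * int m - 1) * kappa l k + lin m k" for k
  proof -
    have "(\<Sum>i\<in>{1..4 * m}. theta_exp (4 * int m - 1) (root_offset m i) (diffs k i))
      = (\<Sum>i\<in>{1..4 * m}. theta_exp (4 * int m - 1) (root_offset m i) (ext k i - ext k (i - 1)))"
      by (intro sum.cong refl) (simp add: diffs_def l)
    also have "\<dots> = (4 * int m - 1) * kappa l (ext k) + lin m (ext k)"
      unfolding l_def by (rule sum_theta_exp_differences[OF assms(1)]) (simp_all add: ext_def l)
    also have "kappa l (ext k) = kappa l k"
      unfolding kappa_def by (intro arg_cong2[of _ _ _ _ "(-)"] sum.cong refl) (auto simp: ext_def)
    also have "lin m (ext k) = lin m k"
      unfolding lin_def using assms(1)
      by (intro arg_cong2[of _ _ _ _ "(-)"] arg_cong2[of _ _ _ _ "(+)"] sum.cong refl) (auto simp: ext_def l_def)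
    finally show ?thesis .
  qed
  have "((\<lambda>k. q powi ((4 * int m - 1) * kappa l k + lin m k)) has_sum s) (int_tuples l)
      = ((\<lambda>x. q powi (\<Sum>i\<in>{1..4 * m}. theta_exp (4 * int m - 1) (root_offset m i) (x i))) has_sum s)
        {x. x \<in> {1..4 * m} \<rightarrow>\<^sub>E UNIV \<and> sum x {1..4 * m} = 0}" for s
  proof (rule has_sum_reindex_bij_witness[of _ psums diffs])
    fix k assume k: "k \<in> int_tuples l"
    show "psums (diffs k) = k"
    proof
      fix i
      have "(\<Sum>j=1..i. diffs k j) = ext k i" if "i \<in> {1..l}"
        using that by (intro trans[OF _ tele] sum.cong refl) (auto simp: diffs_def)
      then show "psums (diffs k) i = k i"
        using k by (auto simp: psums_def ext_def int_tuples_def PiE_iff extensional_def)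
    qed
    have "sum (diffs k) {1..Suc l} = ext k (Suc l)"
      by (intro trans[OF _ tele] sum.cong refl) (simp add: diffs_def)
    then show "diffs k \<in> {x. x \<in> {1..4 * m} \<rightarrow>\<^sub>E UNIV \<and> sum x {1..4 * m} = 0}"
      unfolding l by (simp add: diffs_def ext_def del: sum.cl_ivl_Suc)
    show "q powi (\<Sum>i\<in>{1..4 * m}. theta_exp (4 * int m - 1) (root_offset m i) (diffs k i))
        = q powi ((4 * int m - 1) * kappa l k + lin m k)"
      unfolding exponent ..
  next
    fix x :: "nat \<Rightarrow> int"
    assume "x \<in> {x. x \<in> {1..4 * m} \<rightarrow>\<^sub>E UNIV \<and> sum x {1..4 * m} = 0}"
    then have x: "x \<in> {1..Suc l} \<rightarrow>\<^sub>E UNIV" "sum x {1..Suc l} = 0"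
      unfolding l by auto
    show "psums x \<in> int_tuples l"
      by (simp add: psums_def int_tuples_def)
    have ext: "ext (psums x) i = (\<Sum>j=1..i. x j)" if "i \<le> Suc l" for i
      using that x(2) by (cases "i = Suc l"; cases "i = 0") (auto simp: ext_def psums_def)
    show "diffs (psums x) = x"
    proof
      fix i
      show "diffs (psums x) i = x i"
      proof (cases "i \<in> {1..Suc l}")
        case True
        then obtain j where "i = Suc j" "j \<le> l"
          by (cases i) auto
        then show ?thesis
          by (simp add: diffs_def ext)
      qed (use x(1) in \<open>auto simp: diffs_def PiE_iff extensional_def\<close>)
    qed
  qed simp
  then show ?thesis
    using has_sum_root_lattice[OF assms(1), where 'a = rat] unfolding q_def l_def by blast
qed

end
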